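(* Let $k,n$ be positive integers with $\gcd(k,n)=1$. If $k\equiv\pm 2\pmod n$, then for every pair of distinct nonzero $v_1,v_2\in\mathbb{F}_{2^n}$, $$\bigl|\{(x,y,z)\in\Delta^3:\ v_1x+v_2y+(v_1+v_2)z=0\}\bigr|=2^{2n-3}.$$ Together with the case $k\equiv\pm1\pmod n$, the same equality (for all distinct nonzero $v_1,v_2$) holds whenever $\gcd(k,n)=1$ and $k$ is congruent modulo $n$ to one of $1,\,2,\,n-2,\,n-1$.
   Context: $\mathbb{F}_{2^n}$ is the field with $2^n$ elements. For positive integers $k,n$ put $F(x)=x^{4^k-2^k+1}$ for $x\in\mathbb{F}_{2^n}$, $\delta(b)=F(b)+F(b+1)+1$, and $\Delta=\{\delta(b): b\in\mathbb{F}_{2^n}\}$. *)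

theory Defs
  imports "HOL-Number_Theory.Cong" "HOL-Library.Cardinality"
begin

definition kasami_F :: "nat \<Rightarrow> 'a::field \<Rightarrow> 'a" where
  "kasami_F k x = x ^ (4 ^ k - 2 ^ k + 1)"

definition kasami_\<delta> :: "nat \<Rightarrow> 'a::field \<Rightarrow> 'a" where
  "kasami_\<delta> k b = kasami_F k b + kasami_F k (b + 1) + 1"

definition kasami_\<Delta> :: "nat \<Rightarrow> 'a::field set" where
  "kasami_\<Delta> k = range (kasami_\<delta> k)"

definition zero_sum_triples :: "nat \<Rightarrow> 'a::field \<Rightarrow> 'a \<Rightarrow> ('a \<times> 'a \<times> 'a) set" where
  "zero_sum_triples k v1 v2 =
     {(x, y, z). x \<in> kasami_\<Delta> k \<and> y \<in> kasami_\<Delta> k \<and> z \<in> kasami_\<Delta> k \<and>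
                 v1 * x + v2 * y + (v1 + v2) * z = 0}"

end

theory Submission
  imports Defs
begin

text \<open>
  Modulo Frobenius, \<open>k\<close> may be replaced by \<open>\<plusminus>k mod n\<close>. For \<open>k = 1\<close> the set \<open>\<Delta>\<close> is the
  trace-zero hyperplane \<open>H = {b^2 + b}\<close>, and the equation is a surjective linear form on \<open>H^3\<close>.

  For \<open>k = 2\<close> the degree \<open>n\<close> is odd and \<open>\<delta>(b) = P(b^2 + b + 1)\<close> with \<open>P(t) = t^6 + t^5\<close> (below: \<open>segre\<close>). This
  polynomial belongs to the Segre hyperoval: it is exactly two-to-one on the whole field, and the
  two points of a fibre have different traces. Hence \<open>\<Delta>\<close> is the image of \<open>P\<close>, and the count is one
  eighth of the number of \<open>w\<close> with \<open>A(w) + B(w) = 0\<close>, where \<open>A\<close> and \<open>B\<close> are the diagonal forms of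
  degrees 6 and 5 with coefficients \<open>v1, v2, v1 + v2\<close>. On the line through a point \<open>w\<close>, the equation
  reads \<open>l A(w) = B(w)\<close>, so only the zeros of \<open>A\<close> and of \<open>B\<close> have to be counted; each has \<open>q^2\<close>
  because sixth and fifth powers are permutations, and two-to-oneness of \<open>P\<close> forces the common
  zeros onto the diagonal.
\<close>

section \<open>Fibre counting and basic facts on finite fields\<close>

lemma card_eq_mult_card_image:
  assumes "finite A" and "\<And>y. y \<in> f ` A \<Longrightarrow> card {x \<in> A. f x = y} = c"
  shows "card A = c * card (f ` A)"
proof -
  have "card A = (\<Sum>y\<in>f ` A. card {x \<in> A. f x = y})"
    using sum.group[of A "f ` A" f "\<lambda>_. 1::nat"] assms(1) by simp
  also have "\<dots> = c * card (f ` A)"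
    using assms(2) by simp
  finally show ?thesis .
qed

text \<open>Multiplication by a nonzero \<open>x\<close> permutes the nonzero elements, so their
  product absorbs the factor \<open>x ^ (CARD('a) - 1)\<close>.\<close>

lemma finite_field_power_card:
  fixes x :: "'a::{field,finite}"
  shows "x ^ CARD('a) = x"
proof (cases "x = 0")
  case False
  have "(\<Prod>y\<in>UNIV - {0}. y) = (\<Prod>y\<in>UNIV - {0}. x * y)"
    by (rule prod.reindex_bij_witness[of _ "\<lambda>y. x * y" "\<lambda>y. y / x"]) (use False in auto)
  also have "\<dots> = x ^ (CARD('a) - 1) * (\<Prod>y\<in>UNIV - {0}. y)"
    by (simp add: prod.distrib card_Diff_singleton)
  finally have "x ^ (CARD('a) - 1) = 1"
    by simp
  then have "x * x ^ (CARD('a) - 1) = x"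
    by simp
  then show ?thesis
    by (simp flip: power_Suc)
qed simp

lemma finite_field_of_nat_card: "of_nat CARD('a::{field,finite}) = (0::'a)"
proof -
  have "(\<Sum>y\<in>UNIV. y) = (\<Sum>y\<in>UNIV. y + (1::'a))"
    by (rule sum.reindex_bij_witness[of _ "\<lambda>y. y + 1" "\<lambda>y. y - 1"]) auto
  then show ?thesis
    by (simp add: sum.distrib)
qed

section \<open>Characteristic two and the Frobenius map\<close>

locale binary_field =
  fixes n :: nat and F :: "'a::{field,finite} itself"
  assumes card_field: "CARD('a) = 2 ^ n"
begin

lemma two_eq_zero: "(2::'a) = 0"
  using finite_field_of_nat_card[where 'a = 'a] by (simp add: card_field)

lemma add_self [simp]: "x + x = (0::'a)"
  using two_eq_zero by (metis mult_2 mult_zero_left)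

lemma add_self_left [simp]: "x + (x + y) = (y::'a)"
  by (simp flip: add.assoc)

lemma numeral_Bit0_eq_zero [simp]: "numeral (num.Bit0 m) = (0::'a)"
  by (simp add: numeral_Bit0)

lemma numeral_Bit1_eq_one [simp]: "numeral (num.Bit1 m) = (1::'a)"
  by (simp add: numeral_Bit1)

lemma add_eq_zero_iff: "x + y = 0 \<longleftrightarrow> x = (y::'a)"
  by (metis add_self add_left_cancel)

text \<open>Monomials are sorted by \<^term>\<open>(+)\<close>-commutativity, so equal ones become adjacent and cancel
  by the rules above.\<close>

lemmas expand = algebra_simps eval_nat_numeral

lemma frobenius_add: "(x + y) ^ (2 ^ m) = x ^ (2 ^ m) + (y::'a) ^ (2 ^ m)"
proof (induction m)
  case (Suc m)
  have "(x + y) ^ (2 ^ Suc m) = ((x + y) ^ (2 ^ m))\<^sup>2"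
    by (simp add: mult.commute flip: power_mult)
  also have "\<dots> = (x ^ (2 ^ m))\<^sup>2 + (y ^ (2 ^ m))\<^sup>2"
    unfolding Suc by (simp add: power2_sum)
  finally show ?case
    by (simp add: mult.commute flip: power_mult)
qed simp

lemma frobenius_period: "(x::'a) ^ (2 ^ (n * m)) = x"
proof (induction m)
  case (Suc m)
  have "x ^ (2 ^ (n * Suc m)) = (x ^ (2 ^ (n * m))) ^ (2 ^ n)"
    by (simp add: power_add mult.commute flip: power_mult)
  then show ?case
    using Suc finite_field_power_card[of x] by (simp add: card_field)
qed simp

lemma frobenius_cong:
  assumes "[i = j] (mod n)"
  shows "(x::'a) ^ (2 ^ i) = x ^ (2 ^ j)"
proof -
  have *: "x ^ (2 ^ i) = x ^ (2 ^ (i mod n))" for i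
  proof -
    have "x ^ (2 ^ i) = (x ^ (2 ^ (n * (i div n)))) ^ (2 ^ (i mod n))"
      by (simp flip: power_mult power_add)
    then show ?thesis
      by (simp add: frobenius_period)
  qed
  show ?thesis
    using assms *[of i] *[of j] by (simp add: cong_def)
qed

lemma frobenius_inj: "inj (\<lambda>x::'a. x ^ (2 ^ m))"
proof (rule injI)
  fix x y :: 'a
  assume "x ^ (2 ^ m) = y ^ (2 ^ m)"
  then have "(x + y) ^ (2 ^ m) = 0"
    by (simp add: frobenius_add)
  then show "x = y"
    by (simp add: add_eq_zero_iff)
qed

section \<open>Dependence of the Kasami set on \<open>k\<close> modulo \<open>n\<close> and up to
  sign\<close>

lemma kasami_F_mult: "kasami_F k x * x ^ (2 ^ k) = x ^ (2 ^ (2 * k)) * (x::'a)"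
proof -
  have "(2::nat) ^ k \<le> 4 ^ k"
    by (rule power_mono) auto
  then have "4 ^ k - 2 ^ k + 1 + 2 ^ k = 2 ^ (2 * k) + (1::nat)"
    by (simp add: power_mult)
  then have "x ^ (4 ^ k - 2 ^ k + 1 + 2 ^ k) = x ^ (2 ^ (2 * k) + 1)"
    by (rule arg_cong)
  then show ?thesis
    by (simp add: kasami_F_def power_add)
qed

text \<open>Clearing the subtraction in the exponent leaves only Frobenius powers, which depend on
  their index modulo \<open>n\<close>. At \<open>x = 0\<close> the cleared equation says nothing,
  hence the second premise.\<close>

lemma kasami_F_eqI:
  assumes "y * x ^ (2 ^ k) = x ^ (2 ^ (2 * k)) * (x::'a)" and "x = 0 \<Longrightarrow> y = 0"
  shows "kasami_F k x = y"
proof (cases "x = 0")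
  case True
  then show ?thesis
    using assms(2) by (simp add: kasami_F_def)
next
  case False
  have "kasami_F k x * x ^ (2 ^ k) = y * x ^ (2 ^ k)"
    using assms(1) kasami_F_mult by simp
  with False show ?thesis
    by simp
qed

lemma kasami_Delta_cong:
  assumes "[k = l] (mod n)"
  shows "kasami_\<Delta> k = (kasami_\<Delta> l :: 'a set)"
proof -
  have "kasami_F k x = kasami_F l x" for x :: 'a
  proof (rule kasami_F_eqI)
    have "[2 * k = 2 * l] (mod n)"
      using assms by (rule cong_scalar_left)
    then show "kasami_F l x * x ^ (2 ^ k) = x ^ (2 ^ (2 * k)) * x"
      using kasami_F_mult[of l x] frobenius_cong[OF assms, of x]
        frobenius_cong[of "2 * k" "2 * l" x] by simp
  qed (simp add: kasami_F_def)
  then show ?thesis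
    by (simp add: kasami_\<Delta>_def kasami_\<delta>_def)
qed

text \<open>Multiplying \<open>4^k - 2^k + 1\<close> by \<open>4^l\<close> gives
  \<open>1 - 2^l + 4^l\<close> modulo \<open>2^n - 1\<close>, so the Frobenius power
  \<open>\<phi>\<close> carries \<open>kasami_F k\<close> to \<open>kasami_F l\<close>. As
  \<open>\<phi>\<close> is bijective and commutes with \<open>kasami_\<delta> l\<close>, the two
  maps differ only by a permutation of the argument.\<close>

lemma kasami_Delta_cong_uminus:
  assumes "[k + l = 0] (mod n)"
  shows "kasami_\<Delta> k = (kasami_\<Delta> l :: 'a set)"
proof -
  define \<phi> where "\<phi> = (\<lambda>x::'a. x ^ (2 ^ (2 * l)))"
  have inj: "inj \<phi>"
    unfolding \<phi>_def by (rule frobenius_inj)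
  have surj: "surj \<phi>"
    using inj by (simp add: finite_UNIV_inj_surj)
  have add: "\<phi> (x + y) = \<phi> x + \<phi> y" for x y
    by (simp add: \<phi>_def frobenius_add)
  have F: "\<phi> (kasami_F k x) = kasami_F l x" for x
  proof (rule kasami_F_eqI[symmetric])
    show "\<phi> (kasami_F k x) * x ^ (2 ^ l) = x ^ (2 ^ (2 * l)) * x"
    proof -
      have "[k + 2 * l = l] (mod n)"
        using cong_add[OF assms cong_refl[of l]] by (simp add: mult_2 add.assoc)
      then have 1: "\<phi> (x ^ (2 ^ k)) = x ^ (2 ^ l)"
        using frobenius_cong[of "k + 2 * l" l x] by (simp add: \<phi>_def flip: power_mult power_add)
      have "[2 * k + 2 * l = 0] (mod n)"
        using cong_scalar_left[OF assms, of 2] by simp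
      then have 2: "\<phi> (x ^ (2 ^ (2 * k))) = x"
        using frobenius_cong[of "2 * k + 2 * l" 0 x] by (simp add: \<phi>_def flip: power_mult power_add)
      have "\<phi> (kasami_F k x * x ^ (2 ^ k)) = \<phi> (x ^ (2 ^ (2 * k)) * x)"
        by (simp only: kasami_F_mult)
      then show ?thesis
        unfolding \<phi>_def power_mult_distrib using 1 2 by (simp add: \<phi>_def mult.commute)
    qed
  qed (simp add: \<phi>_def kasami_F_def)
  have \<phi>1: "\<phi> 1 = 1"
    by (simp add: \<phi>_def)
  have k_to_l: "\<phi> (kasami_\<delta> k b) = kasami_\<delta> l b" for b
    by (simp add: kasami_\<delta>_def add F \<phi>1)
  have F_comm: "kasami_F l (\<phi> b) = \<phi> (kasami_F l b)" for b
    unfolding kasami_F_def \<phi>_def by (simp only: mult.commute flip: power_mult)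
  have l_to_l: "kasami_\<delta> l (\<phi> b) = \<phi> (kasami_\<delta> l b)" for b
    using F_comm[of b] F_comm[of "b + 1"] by (simp add: kasami_\<delta>_def add \<phi>1)
  have "kasami_\<delta> k (\<phi> b) = kasami_\<delta> l b" for b
    using k_to_l[of "\<phi> b"] l_to_l[of b] inj by (simp add: inj_eq)
  then have "kasami_\<delta> k \<circ> \<phi> = kasami_\<delta> l"
    by auto
  then have "kasami_\<delta> k ` range \<phi> = range (kasami_\<delta> l)"
    by (metis image_comp)
  then show ?thesis
    using surj by (simp add: kasami_\<Delta>_def)
qed

section \<open>The trace-zero hyperplane as Artin-Schreier image, and the case
  \<open>k = 1\<close>\<close>

definition H :: "'a set" where
  "H = range (\<lambda>b. b\<^sup>2 + b)"

lemma H_I: "b\<^sup>2 + b \<in> H"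
  by (simp add: H_def)

lemma H_add: "x \<in> H \<Longrightarrow> y \<in> H \<Longrightarrow> x + y \<in> H"
proof -
  assume "x \<in> H" "y \<in> H"
  then obtain b c where "x = b\<^sup>2 + b" "y = c\<^sup>2 + c"
    by (auto simp: H_def)
  then have "x + y = (b + c)\<^sup>2 + (b + c)"
    by (simp add: expand)
  then show ?thesis
    using H_I by simp
qed

lemma zero_in_H: "0 \<in> H"
  using H_I[of 0] by simp

lemma kasami_Delta_1: "kasami_\<Delta> 1 = H"
proof -
  have "kasami_\<delta> 1 b = b\<^sup>2 + b" for b :: 'a
    by (simp add: kasami_\<delta>_def kasami_F_def expand)
  then show ?thesis
    by (simp add: kasami_\<Delta>_def H_def)
qed

lemma card_H: "2 * card H = 2 ^ n"
proof -
  have "card (UNIV :: 'a set) = 2 * card H"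
    unfolding H_def
  proof (rule card_eq_mult_card_image)
    fix y :: 'a
    assume "y \<in> range (\<lambda>b. b\<^sup>2 + b)"
    then obtain b where b: "y = b\<^sup>2 + b"
      by auto
    have "x\<^sup>2 + x = y \<longleftrightarrow> x = b \<or> x = b + 1" for x
    proof -
      have "x\<^sup>2 + x + y = (x + b) * (x + (b + 1))"
        by (simp add: b expand)
      then show ?thesis
        by (metis add_eq_zero_iff mult_eq_0_iff)
    qed
    then have "{x \<in> UNIV. x\<^sup>2 + x = y} = {b, b + 1}"
      by auto
    then show "card {x \<in> UNIV. x\<^sup>2 + x = y} = 2"
      by simp
  qed simp
  then show ?thesis
    by (simp add: card_field)
qed

text \<open>\<open>H\<close> has index two: its translate by \<open>z\<close> is disjoint from it,
  and each has half the size of the field.\<close>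

lemma H_index:
  assumes "z \<notin> H"
  shows "x \<in> H \<or> x + z \<in> H"
proof -
  have "H \<inter> (+) z ` H = {}"
    using assms H_add by (fastforce simp: add.assoc dest: H_add)
  moreover have "card ((+) z ` H) = card H"
    by (simp add: card_image)
  ultimately have "card (H \<union> (+) z ` H) = CARD('a)"
    using card_H by (simp add: card_Un_disjoint card_field)
  then have "H \<union> (+) z ` H = UNIV"
    by (simp add: card_subset_eq)
  then show ?thesis
    by (metis UNIV_I UnE add.commute add_self_left imageE)
qed


text \<open>Translation by \<open>g\<close> identifies the fibre over \<open>f g\<close> with the
  kernel. Addition is a parameter so that it can be componentwise on triples;
  \<open>involutive\<close> encodes characteristic two.\<close>

lemma card_kernel_mult_range:
  fixes G :: "'b set" and f :: "'b \<Rightarrow> 'a" and add :: "'b \<Rightarrow> 'b \<Rightarrow> 'b"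
  assumes "finite G"
    and closed: "\<And>x y. x \<in> G \<Longrightarrow> y \<in> G \<Longrightarrow> add x y \<in> G"
    and involutive: "\<And>x y. add (add x y) y = x"
    and hom: "\<And>x y. f (add x y) = f x + f y"
  shows "card G = card {x \<in> G. f x = 0} * card (f ` G)"
proof (rule card_eq_mult_card_image)
  fix y
  assume "y \<in> f ` G"
  then obtain g where g: "g \<in> G" "f g = y"
    by auto
  have "bij_betw (\<lambda>x. add x g) {x \<in> G. f x = y} {x \<in> G. f x = 0}"
    by (rule bij_betw_byWitness[where f' = "\<lambda>x. add x g"])
      (use g closed hom involutive in auto)
  then show "card {x \<in> G. f x = y} = card {x \<in> G. f x = 0}"
    by (rule bij_betw_same_card)
qed (fact assms)

text \<open>If \<open>c\<close> preserved \<open>H\<close>, so would \<open>1 + c\<close>, and both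
  would permute \<open>H\<close>. For \<open>z\<close> outside \<open>H\<close>, neither
  \<open>c * z\<close> nor \<open>(1 + c) * z\<close> could then lie in \<open>H\<close>, although
  they differ by \<open>z\<close>, against index two.\<close>

lemma H_not_invariant:
  assumes "c \<noteq> 0" and "c \<noteq> 1"
  shows "\<exists>h\<in>H. c * h \<notin> H"
proof (rule ccontr)
  assume "\<not> ?thesis"
  then have closed: "h \<in> H \<Longrightarrow> c * h \<in> H" for h
    by auto
  have surj: "\<exists>h\<in>H. x = a * h" if a: "a \<noteq> 0" "\<And>h. h \<in> H \<Longrightarrow> a * h \<in> H" and "x \<in> H" for a x
  proof -
    have "(*) a ` H = H"
      by (rule endo_inj_surj) (use a in \<open>auto simp: inj_on_def\<close>)
    then show ?thesis
      using \<open>x \<in> H\<close> by blast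
  qed
  have "card H < CARD('a)"
    using card_H zero_less_power[of "2::nat" n] unfolding card_field by linarith
  then obtain z where z: "z \<notin> H"
    by (metis UNIV_eq_I less_irrefl)
  have "c * z \<notin> H"
    using surj[of c "c * z"] closed assms(1) z by auto
  then have "(1 + c) * z \<in> H"
    using H_index[OF z, of "c * z"] by (simp add: algebra_simps)
  moreover have "1 + c \<noteq> 0"
    using assms(2) by (metis add_eq_zero_iff)
  moreover have "(1 + c) * h \<in> H" if "h \<in> H" for h
    using H_add[OF that closed[OF that]] by (simp add: algebra_simps)
  ultimately show False
    using surj[of "1 + c" "(1 + c) * z"] z by auto
qed

lemma card_zero_sum_triples_linear:
  assumes \<Delta>: "kasami_\<Delta> k = H" and v: "v1 \<noteq> 0" "v2 \<noteq> 0" "v1 \<noteq> (v2::'a)" and "n \<ge> 2"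
  shows "card (zero_sum_triples k v1 v2) = 2 ^ (2 * n - 3)"
proof -
  define G where "G = H \<times> H \<times> H"
  define f where "f = (\<lambda>(x, y, z). v1 * x + v2 * y + (v1 + v2) * z)"
  define add where "add = (\<lambda>(x, y, z) (x', y', z'). (x + x' :: 'a, y + y' :: 'a, z + z' :: 'a))"
  have "card G = card {x \<in> G. f x = 0} * card (f ` G)"
    by (rule card_kernel_mult_range[where add = add])
      (auto simp: G_def f_def add_def H_add algebra_simps)
  moreover have "{x \<in> G. f x = 0} = zero_sum_triples k v1 v2"
    by (auto simp: G_def f_def zero_sum_triples_def \<Delta>)
  moreover have "f ` G = UNIV"
  proof -
    \<comment> \<open>With this \<open>h\<close>, the hyperplane \<open>v1 * H\<close> and its
      translate by \<open>v2 * h\<close> cover the field, so the form is onto already with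
      \<open>z = 0\<close>.\<close>
    obtain h where h: "h \<in> H" "v2 / v1 * h \<notin> H"
      using H_not_invariant[of "v2 / v1"] v by auto
    have "x \<in> f ` G" for x
      using H_index[OF h(2), of "x / v1"]
    proof
      assume "x / v1 \<in> H"
      then have "(x / v1, 0, 0) \<in> G"
        by (simp add: G_def zero_in_H)
      moreover have "f (x / v1, 0, 0) = x"
        using v by (simp add: f_def)
      ultimately show ?thesis
        by (metis image_eqI)
    next
      assume "x / v1 + v2 / v1 * h \<in> H"
      then have "(x / v1 + v2 / v1 * h, h, 0) \<in> G"
        using h by (simp add: G_def zero_in_H)
      moreover have "f (x / v1 + v2 / v1 * h, h, 0) = x"
        using v by (simp add: f_def algebra_simps)
      ultimately show ?thesis
        by (metis image_eqI)
    qed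
    then show ?thesis
      by auto
  qed
  moreover have "card H = 2 ^ (n - 1)"
    using card_H \<open>n \<ge> 2\<close> by (cases n) auto
  ultimately have "2 ^ (n - 1) * (2 ^ (n - 1) * 2 ^ (n - 1)) = card (zero_sum_triples k v1 v2) * 2 ^ n"
    by (simp add: G_def card_cartesian_product card_field)
  moreover have "(n - 1) + ((n - 1) + (n - 1)) = (2 * n - 3) + n"
    using \<open>n \<ge> 2\<close> by simp
  then have "(2::nat) ^ (n - 1) * (2 ^ (n - 1) * 2 ^ (n - 1)) = 2 ^ (2 * n - 3) * 2 ^ n"
    by (simp flip: power_add)
  ultimately show ?thesis
    by simp
qed

end

section \<open>Odd degree: roots of unity and power permutations\<close>

locale odd_binary_field = binary_field +
  assumes odd_n: "odd n"
begin

text \<open>For odd \<open>n\<close>, \<open>2 ^ n\<close> is 2 modulo 3, so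
  \<open>x ^ (2 ^ n) = x\<close> becomes \<open>x\<^sup>2 = x\<close>.\<close>

lemma cube_root_of_unity: "x ^ 3 = 1 \<Longrightarrow> x = (1::'a)"
proof -
  assume x: "x ^ 3 = 1"
  have "[2 ^ n = 2] (mod 3::nat)"
  proof -
    obtain m where "n = 2 * m + 1"
      using odd_n by (elim oddE)
    then have "(2::nat) ^ n = 4 ^ m * 2"
      by (simp add: power_mult)
    moreover have "[4 ^ m = 1] (mod 3::nat)"
      using cong_pow[of 4 1 "3::nat" m] by (simp add: cong_def)
    then have "[4 ^ m * 2 = 2] (mod 3::nat)"
      using cong_scalar_right by fastforce
    ultimately show ?thesis
      by simp
  qed
  then have "(2::nat) ^ n mod 3 = 2"
    by (simp add: cong_def)
  then obtain j :: nat where "2 ^ n = 3 * j + 2"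
    by (metis mult_div_mod_eq)
  then have "x ^ (2 ^ n) = (x ^ 3) ^ j * x\<^sup>2"
    by (simp only: power_add power_mult)
  then have "x\<^sup>2 = x"
    using x finite_field_power_card[of x] by (simp add: card_field)
  moreover have "x \<noteq> 0"
    using x by auto
  ultimately show ?thesis
    by (simp add: power2_eq_square)
qed

text \<open>For odd \<open>n\<close>, \<open>2 ^ n\<close> is 2 or 3 modulo 5; both residues force
  \<open>x = 1\<close> in characteristic two.\<close>

lemma fifth_root_of_unity: "x ^ 5 = 1 \<Longrightarrow> x = (1::'a)"
proof -
  assume x: "x ^ 5 = 1"
  have x0: "x \<noteq> 0"
    using x by auto
  obtain m where m: "n = 2 * m + 1"
    using odd_n by (elim oddE)
  have "[4 ^ m = 1] (mod 5::nat) \<or> [4 ^ m = 4] (mod 5::nat)"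
  proof (induction m)
    case (Suc m)
    then show ?case
      by (auto simp: cong_def mod_mult_right_eq[symmetric, of 4 "4 ^ m" "5::nat"])
  qed (simp add: cong_def)
  then have "(2 ^ n) mod 5 = (2::nat) \<or> (2 ^ n) mod 5 = (3::nat)"
    using mod_mult_right_eq[of 2 "4 ^ m" "5::nat"]
    by (auto simp: m power_mult cong_def)
  then obtain r j :: nat where "r = 2 \<or> r = 3" "2 ^ n = 5 * j + r"
    by (metis mult_div_mod_eq)
  moreover have "x ^ (2 ^ n) = x"
    using finite_field_power_card[of x] by (simp add: card_field)
  ultimately have "x ^ 2 = x \<or> x ^ 3 = x"
    using x by (auto simp: power_add power_mult)
  then have "x = 1 \<or> x\<^sup>2 = 1"
    using x0 by (auto simp: eval_nat_numeral)
  moreover have "x ^ 2 + 1 = (x + 1) ^ 2"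
    by (simp add: expand)
  ultimately show ?thesis
    by (metis add_eq_zero_iff power_eq_0_iff)
qed

lemma power_inj:
  assumes "\<And>u. u ^ m = 1 \<Longrightarrow> u = (1::'a)" and "m > 0"
  shows "inj (\<lambda>x::'a. x ^ m)"
proof (rule injI)
  fix x y :: 'a
  assume eq: "x ^ m = y ^ m"
  show "x = y"
  proof (cases "y = 0")
    case False
    then have "(x / y) ^ m = 1"
      by (simp add: power_divide eq)
    then have "x / y = 1"
      by (rule assms(1))
    with False show ?thesis
      by simp
  qed (use eq \<open>m > 0\<close> in \<open>simp add: zero_power\<close>)
qed

lemma inj_power5: "inj (\<lambda>x::'a. x ^ 5)"
  by (rule power_inj) (auto intro: fifth_root_of_unity)

lemma inj_power6: "inj (\<lambda>x::'a. x ^ 6)"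
proof (rule power_inj)
  fix u :: 'a
  assume "u ^ 6 = 1"
  then have "(u ^ 2) ^ 3 = 1"
    by (simp flip: power_mult)
  then have "u ^ 2 = 1"
    by (rule cube_root_of_unity)
  moreover have "u ^ 2 + 1 = (u + 1) ^ 2"
    by (simp add: expand)
  ultimately show "u = 1"
    by (metis add_eq_zero_iff power_eq_0_iff)
qed simp

text \<open>A solution of \<open>b\<^sup>2 + b = 1\<close> would be a nontrivial cube root of
  unity.\<close>

lemma one_notin_H: "1 \<notin> H"
proof
  assume "1 \<in> H"
  then obtain b where b: "b\<^sup>2 + b = (1::'a)"
    by (auto simp: H_def)
  have "b ^ 3 + 1 = (b + 1) * (b\<^sup>2 + b + 1)"
    by (simp add: expand)
  then have "b ^ 3 = 1"
    by (simp add: b add_eq_zero_iff)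
  then have "b = 1"
    by (rule cube_root_of_unity)
  then show False
    using b by simp
qed

section \<open>Fibres of the Segre polynomial\<close>

definition segre :: "'a \<Rightarrow> 'a" where
  "segre t = t ^ 6 + t ^ 5"

lemma segre_eq_imp:
  assumes "segre s = segre t" and "s \<noteq> t"
  shows "s + t + 1 \<in> H"
proof -
  define d where "d = s + t"
  \<comment> \<open>Now \<open>t + 1 = d * r\<close> and \<open>s + 1 = d * (r + 1)\<close>, so
    swapping \<open>s\<close> and \<open>t\<close> shifts \<open>r\<close> by 1 and fixes
    \<open>r\<^sup>2 + r\<close>.\<close>
  define r where "r = (t + 1) / d"
  have d: "d \<noteq> 0"
    using assms(2) by (simp add: d_def add_eq_zero_iff)
  have t: "t = d * r + 1"
    using d by (simp add: r_def add.assoc)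
  have s: "s = d * r + 1 + d"
    by (metis d_def t add.commute add_self_left)
  \<comment> \<open>With \<open>w = r\<^sup>2 + r\<close>, the equation \<open>P(s) = P(t)\<close> is quadratic in \<open>w\<close>; \<open>V / d\<^sup>2\<close> is its
    Artin--Schreier variable.\<close>
  define V where "V = d\<^sup>2 * (r\<^sup>2 + r) * (d + 1) + (d + 1) ^ 3 + d"
  \<comment> \<open>The factor \<open>d + 1\<close> makes the quadratic monic in \<open>V\<close>.
    It is never cancelled, so \<open>d = 1\<close> needs no separate case.\<close>
  have "d * (V\<^sup>2 + d\<^sup>2 * V + d ^ 4 * (d + 1)) = (d + 1) * (segre s + segre t)"
    by (simp add: V_def segre_def s t expand)
  then have V: "V\<^sup>2 + d\<^sup>2 * V = d ^ 4 * (d + 1)"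
    using d assms(1) by (simp add: add_eq_zero_iff)
  have "(V / d\<^sup>2)\<^sup>2 + V / d\<^sup>2 = (V\<^sup>2 + d\<^sup>2 * V) / d ^ 4"
    using d by (simp add: field_simps eval_nat_numeral)
  also have "\<dots> = d + 1"
    using d by (simp add: V)
  finally show ?thesis
    using H_I[of "V / d\<^sup>2"] by (simp add: d_def)
qed

text \<open>Three distinct points would have pairwise different traces, but there are only two
  values.\<close>

lemma segre_fibre:
  assumes "segre x = segre y" and "segre x = segre z" and "x \<noteq> y" and "x \<noteq> z"
  shows "y = z"
proof (rule ccontr)
  assume "y \<noteq> z"
  then have "x + y + 1 \<in> H" "x + z + 1 \<in> H" "y + z + 1 \<in> H"
    using assms by (auto intro!: segre_eq_imp)
  then have "(x + y + 1) + (x + z + 1) + (y + z + 1) \<in> H"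
    by (rule H_add[OF H_add])
  also have "(x + y + 1) + (x + z + 1) + (y + z + 1) = 1"
    by (simp add: algebra_simps)
  finally show False
    using one_notin_H by simp
qed

text \<open>The points \<open>f r\<close> and \<open>f (r + 1)\<close> always share a fibre. Since
  fibres have at most two points, \<open>f\<close> is injective, hence onto the finite field, and
  every \<open>t\<close> has a partner.\<close>

lemma segre_partner: "\<exists>s. s \<noteq> t \<and> segre s = segre t"
proof -
  \<comment> \<open>Solving \<open>P(s) = P(t)\<close> with \<open>s + t = d\<close> and \<open>t = d r\<close> gives \<open>d = m r / (e r)\<^sup>2\<close>.\<close>
  define e where "e = (\<lambda>r::'a. r\<^sup>2 + r + 1)"
  define m where "m = (\<lambda>r::'a. r ^ 4 + r + 1)"
  define f where "f = (\<lambda>r. r * m r / (e r)\<^sup>2)"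
  have e: "e r \<noteq> 0" for r
    using one_notin_H H_I[of r] by (auto simp: e_def add_eq_zero_iff)
  have m: "m r \<noteq> 0" for r
  proof -
    have "m r = (e r)\<^sup>2 + e r + 1"
      by (simp add: m_def e_def expand)
    then show ?thesis
      using one_notin_H H_I[of "e r"] by (auto simp: add_eq_zero_iff)
  qed
  have shift: "e (r + 1) = e r" "m (r + 1) = m r" for r
    by (simp_all add: e_def m_def expand)
  have diff: "f (r + 1) = f r + m r / (e r)\<^sup>2" for r
    unfolding f_def shift by (simp add: add_divide_distrib algebra_simps)
  then have neq: "f (r + 1) \<noteq> f r" for r
    using e m by simp
  \<comment> \<open>This form is visibly invariant under \<open>r\<close> to
    \<open>r + 1\<close>.\<close>
  have p_f: "segre (f r) = (r * (r + 1) * m r) ^ 5 / e r ^ 12" for r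
  proof -
    have "r * m r + (e r)\<^sup>2 = (r + 1) ^ 5"
      by (simp add: m_def e_def expand)
    then have "f r + 1 = (r + 1) ^ 5 / (e r)\<^sup>2"
      using e[of r] by (simp add: f_def field_simps)
    then have "f r ^ 5 * (f r + 1) = (r * m r / (e r)\<^sup>2) ^ 5 * ((r + 1) ^ 5 / (e r)\<^sup>2)"
      by (simp add: f_def)
    also have "\<dots> = (r * (r + 1) * m r) ^ 5 / e r ^ 12"
      by (simp add: power_divide power_mult_distrib flip: power_mult power_add)
    finally show ?thesis
      by (simp add: segre_def expand)
  qed
  have p_shift: "segre (f (r + 1)) = segre (f r)" for r
    by (simp add: p_f shift mult.commute add.assoc)
  have "inj f"
  proof (rule injI)
    fix r s
    assume eq: "f r = f s"
    \<comment> \<open>Both are the second point of the fibre through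
      \<open>f r = f s\<close>.\<close>
    have "f (r + 1) = f (s + 1)"
      by (rule segre_fibre[of "f r"]) (use neq p_shift eq in metis)+
    then have "m r / (e r)\<^sup>2 = m s / (e s)\<^sup>2"
      using eq by (simp add: diff)
    then have "r * (m s / (e s)\<^sup>2) = s * (m s / (e s)\<^sup>2)"
      using eq unfolding f_def by (simp flip: times_divide_eq_right)
    then show "r = s"
      using m[of s] e[of s] by simp
  qed
  then have "surj f"
    by (simp add: finite_UNIV_inj_surj)
  then obtain r where "t = f r"
    by blast
  then show ?thesis
    using neq p_shift by blast
qed

lemma card_segre_fibre:
  assumes "y \<in> range segre"
  shows "card {x. segre x = y} = 2"
proof -
  obtain t where t: "y = segre t"
    using assms by auto
  obtain s where s: "s \<noteq> t" "segre s = segre t"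
    using segre_partner by blast
  have "x = s" if "segre x = y" "x \<noteq> t" for x
    using segre_fibre[of t x s] s t that by metis
  then have "{x. segre x = y} = {t, s}"
    using s t by blast
  then show ?thesis
    using s by simp
qed

text \<open>A priori only arguments in \<open>1 + H\<close> occur. For any other \<open>t\<close>,
  the second point of its fibre has the other trace and so lies in \<open>1 + H\<close>.\<close>

lemma kasami_Delta_2: "kasami_\<Delta> 2 = range segre"
proof
  have \<delta>: "kasami_\<delta> 2 b = segre (b\<^sup>2 + b + 1)" for b :: 'a
    by (simp add: kasami_\<delta>_def kasami_F_def segre_def expand)
  then show "kasami_\<Delta> 2 \<subseteq> range segre"
    by (auto simp: kasami_\<Delta>_def)
  have *: "segre t \<in> kasami_\<Delta> 2" if t: "t + 1 \<in> H" for t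
  proof -
    obtain b where "t + 1 = b\<^sup>2 + b"
      using t unfolding H_def by blast
    then have "t = b\<^sup>2 + b + 1"
      by (metis add.commute add_self_left)
    then show ?thesis
      unfolding kasami_\<Delta>_def using \<delta> by (metis rangeI)
  qed
  show "range segre \<subseteq> kasami_\<Delta> 2"
  proof
    fix y
    assume "y \<in> range segre"
    then obtain t where t: "y = segre t"
      by auto
    obtain s where s: "s \<noteq> t" "segre s = segre t"
      using segre_partner by blast
    show "y \<in> kasami_\<Delta> 2"
      using H_index[OF one_notin_H, of t]
    proof
      assume "t \<in> H"
      moreover have "s + t + 1 \<in> H"
        using s by (intro segre_eq_imp)
      ultimately have "t + (s + t + 1) \<in> H"
        by (rule H_add)
      then have "s + 1 \<in> H"
        by (simp add: algebra_simps)
      then show ?thesis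
        using * s t by metis
    qed (use * t in auto)
  qed
qed


section \<open>Zeros of diagonal forms and the case \<open>k = 2\<close>\<close>

definition form :: "'a \<Rightarrow> 'a \<Rightarrow> nat \<Rightarrow> 'a \<times> 'a \<times> 'a \<Rightarrow> 'a" where
  "form v1 v2 m = (\<lambda>(x, y, z). v1 * x ^ m + v2 * y ^ m + (v1 + v2) * z ^ m)"

definition scale :: "'a \<Rightarrow> 'a \<times> 'a \<times> 'a \<Rightarrow> 'a \<times> 'a \<times> 'a" where
  "scale l = (\<lambda>(x, y, z). (l * x, l * y, l * z))"

lemma form_scale: "form v1 v2 m (scale l w) = l ^ m * form v1 v2 m w"
  by (auto simp: form_def scale_def algebra_simps split: prod.splits)

text \<open>The last two coordinates are free and determine the first, as the power map is a
  permutation.\<close>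

lemma card_form_eq_zero:
  assumes "inj (\<lambda>x::'a. x ^ m)" and v1: "v1 \<noteq> 0"
  shows "card {w. form v1 v2 m w = 0} = 2 ^ n * 2 ^ n"
proof -
  have iff: "form v1 v2 m (x, y, z) = 0 \<longleftrightarrow> x ^ m = (v2 * y ^ m + (v1 + v2) * z ^ m) / v1" for x y z
    using v1 by (auto simp: form_def add_eq_zero_iff field_simps)
  have "inj_on snd {w. form v1 v2 m w = 0}"
    using assms(1) by (auto simp: inj_on_def iff)
  then have "card {w. form v1 v2 m w = 0} = card (snd ` {w. form v1 v2 m w = 0})"
    by (simp add: card_image)
  also have "snd ` {w. form v1 v2 m w = 0} = UNIV"
  proof -
    have "u \<in> snd ` {w. form v1 v2 m w = 0}" for u
    proof (cases u)
      case (Pair y z)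
      have "surj (\<lambda>x::'a. x ^ m)"
        using assms(1) by (simp add: finite_UNIV_inj_surj)
      then obtain x where "(v2 * y ^ m + (v1 + v2) * z ^ m) / v1 = x ^ m"
        by (rule surjE)
      then have "form v1 v2 m (x, y, z) = 0"
        by (simp add: iff)
      then show ?thesis
        unfolding Pair by (intro image_eqI[of _ _ "(x, y, z)"]) auto
    qed
    then show ?thesis
      by auto
  qed
  finally show ?thesis
    by (simp add: card_field)
qed

lemma forms_common_zero:
  assumes v: "v1 \<noteq> 0" "v2 \<noteq> 0" "v1 \<noteq> v2"
    and zero: "form v1 v2 6 (x, y, z) = 0" "form v1 v2 5 (x, y, z) = 0"
  shows "x = z \<and> y = z"
proof (rule ccontr)
  assume neq: "\<not> ?thesis"
  have eq: "v1 * (x ^ m + z ^ m) = v2 * (y ^ m + z ^ m)" if "form v1 v2 m (x, y, z) = 0" for m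
  proof -
    have "v1 * (x ^ m + z ^ m) + v2 * (y ^ m + z ^ m) = form v1 v2 m (x, y, z)"
      by (simp add: form_def algebra_simps)
    then show ?thesis
      using that by (simp add: add_eq_zero_iff)
  qed
  have power5: "a ^ 5 = b ^ 5 \<longleftrightarrow> a = b" and power6: "a ^ 6 = b ^ 6 \<longleftrightarrow> a = b" for a b :: 'a
    using inj_power5 inj_power6 by (auto dest: injD)
  have yz: "y \<noteq> z" and xz: "x \<noteq> z"
    using eq[OF zero(2)] neq v by (auto simp: add_eq_zero_iff power5)
  have xy: "x \<noteq> y"
    using eq[OF zero(2)] yz v by (auto simp: add_eq_zero_iff power5)
  \<comment> \<open>The two forms give the same ratio for \<open>y\<close> in place of
    \<open>x\<close>. Since \<open>u ^ 6 + c * u ^ 5\<close> is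
    \<open>c ^ 6 * segre (u / c)\<close>, the three scaled coordinates then lie in one
    fibre.\<close>
  define c where "c = (x ^ 6 + z ^ 6) / (x ^ 5 + z ^ 5)"
  have x5: "x ^ 5 + z ^ 5 \<noteq> 0" and y5: "y ^ 5 + z ^ 5 \<noteq> 0" and x6: "x ^ 6 + z ^ 6 \<noteq> 0"
    using xz yz by (auto simp: add_eq_zero_iff power5 power6)
  have c: "c \<noteq> 0"
    using x5 x6 by (simp add: c_def)
  have cx: "x ^ 6 + z ^ 6 = c * (x ^ 5 + z ^ 5)"
    using x5 by (simp add: c_def)
  have "v2 * (y ^ 6 + z ^ 6) = c * (v1 * (x ^ 5 + z ^ 5))"
    using eq[OF zero(1)] cx by (simp add: mult.left_commute)
  also have "\<dots> = v2 * (c * (y ^ 5 + z ^ 5))"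
    unfolding eq[OF zero(2)] by (simp add: mult.left_commute)
  finally have cy: "y ^ 6 + z ^ 6 = c * (y ^ 5 + z ^ 5)"
    using v by simp
  have "segre (z / c) = segre (t / c)" if "t ^ 6 + z ^ 6 = c * (t ^ 5 + z ^ 5)" for t
  proof -
    have segre: "segre (u / c) = (u ^ 6 + c * u ^ 5) / c ^ 6" for u
      using c by (simp add: segre_def power_divide add_divide_distrib eval_nat_numeral)
    have "(t ^ 6 + c * t ^ 5) + (z ^ 6 + c * z ^ 5) = (t ^ 6 + z ^ 6) + c * (t ^ 5 + z ^ 5)"
      by (simp add: algebra_simps)
    then show ?thesis
      using that by (simp add: segre add_eq_zero_iff)
  qed
  from this[OF cx] this[OF cy] have "x / c = y / c"
    by (rule segre_fibre) (use xz yz c in auto)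
  then show False
    using xy c by simp
qed

lemma card_forms_sum_zero:
  assumes v: "v1 \<noteq> 0" "v2 \<noteq> 0" "v1 \<noteq> v2"
  shows "card {w. form v1 v2 6 w + form v1 v2 5 w = 0} = 2 ^ n * 2 ^ n"
proof -
  define A where "A = form v1 v2 6"
  define B where "B = form v1 v2 5"
  define Z where "Z = {w. A w + B w = 0}"
  let ?q = "2 ^ n :: int"
  have two_le_q: "?q \<ge> 2"
    using odd_n self_le_power[of "2::int" n] by (cases n) auto
  have card_units: "int (card (UNIV - {0::'a})) = ?q - 1"
    by (simp add: card_Diff_singleton card_field)
  have "card {w. A (scale l w) + B (scale l w) = 0} = card Z" if "l \<noteq> 0" for l
  proof (rule bij_betw_same_card)
    show "bij_betw (scale l) {w. A (scale l w) + B (scale l w) = 0} Z"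
      by (rule bij_betw_byWitness[where f' = "scale (1 / l)"])
        (use that in \<open>auto simp: Z_def scale_def\<close>)
  qed
  \<comment> \<open>Count the pairs \<open>(l, w)\<close> with \<open>l \<noteq> 0\<close> and \<open>scale l w \<in> Z\<close> in two ways.\<close>
  then have "(?q - 1) * int (card Z) =
      (\<Sum>l\<in>UNIV - {0}. int (card {w. A (scale l w) + B (scale l w) = 0}))"
    using card_units by simp
  also have "\<dots> = (\<Sum>l\<in>UNIV - {0}. \<Sum>w\<in>UNIV. of_bool (l * A w = B w))"
  proof (rule sum.cong)
    fix l :: 'a
    assume l: "l \<in> UNIV - {0}"
    have "A (scale l w) + B (scale l w) = 0 \<longleftrightarrow> l * A w = B w" for w
    proof -
      have "A (scale l w) + B (scale l w) = l ^ 5 * (l * A w + B w)"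
        by (simp add: A_def B_def form_scale expand)
      then show ?thesis
        using l by (simp add: add_eq_zero_iff)
    qed
    then show "int (card {w. A (scale l w) + B (scale l w) = 0}) =
        (\<Sum>w\<in>UNIV. of_bool (l * A w = B w))"
      by simp
  qed simp
  also have "\<dots> = (\<Sum>w\<in>UNIV. \<Sum>l\<in>UNIV - {0}. of_bool (l * A w = B w))"
    by (rule sum.swap)
  \<comment> \<open>The number of nonzero \<open>l\<close> is 1 if neither value vanishes, 0 if
    exactly one does, and \<open>?q - 1\<close> if both do.\<close>
  also have "\<dots> = (\<Sum>w\<in>UNIV. 1 - of_bool (A w = 0) - of_bool (B w = 0)
      + ?q * of_bool (A w = 0 \<and> B w = 0))"
  proof (rule sum.cong)
    fix w
    have card: "(\<Sum>l\<in>UNIV - {0}. of_bool (l * A w = B w)) =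
        int (card {l \<in> UNIV - {0}. l * A w = B w})"
      by (simp add: Int_def)
    show "(\<Sum>l\<in>UNIV - {0}. of_bool (l * A w = B w)) =
        1 - of_bool (A w = 0) - of_bool (B w = 0) + ?q * of_bool (A w = 0 \<and> B w = 0)"
    proof (cases "A w = 0")
      case True
      then show ?thesis
        using card_units by (cases "B w = 0") auto
    next
      case False
      then have "{l \<in> UNIV - {0}. l * A w = B w} = (if B w = 0 then {} else {B w / A w})"
        by (auto simp: eq_divide_eq)
      with False show ?thesis
        unfolding card by simp
    qed
  qed simp
  also have "\<dots> = int (card (UNIV :: ('a \<times> 'a \<times> 'a) set)) - int (card {w. A w = 0})
      - int (card {w. B w = 0}) + ?q * int (card {w. A w = 0 \<and> B w = 0})"
    by (simp add: sum.distrib sum_subtractf flip: sum_distrib_left)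
  also have "{w. A w = 0 \<and> B w = 0} = range (\<lambda>x. (x, x, x))"
  proof -
    have "w \<in> range (\<lambda>x. (x, x, x))" if "A w = 0" "B w = 0" for w
    proof (cases w)
      case (fields x y z)
      then show ?thesis
        using forms_common_zero[OF v, of x y z] that by (simp add: A_def B_def)
    qed
    \<comment> \<open>The three coefficients sum to zero.\<close>
    moreover have "A (x, x, x) = 0 \<and> B (x, x, x) = 0" for x
      by (simp add: A_def B_def form_def algebra_simps)
    ultimately show ?thesis
      by blast
  qed
  also have "card (range (\<lambda>x::'a. (x, x, x))) = 2 ^ n"
    by (simp add: card_image inj_on_def card_field)
  finally have "(?q - 1) * int (card Z) = (?q - 1) * (?q * ?q)"
    using card_form_eq_zero[OF inj_power6 v(1)] card_form_eq_zero[OF inj_power5 v(1)]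
    by (simp add: A_def B_def card_field algebra_simps)
  then have "int (card Z) = int (2 ^ n * 2 ^ n)"
    using two_le_q odd_n by auto
  then show ?thesis
    unfolding Z_def A_def B_def by (simp only: of_nat_eq_iff)
qed

text \<open>Membership in \<open>Z\<close> depends only on the \<open>segre\<close> values, so
  \<open>Z\<close> is a union of full fibres of \<open>P\<close>, each with \<open>2 ^ 3\<close>
  points.\<close>

lemma card_zero_sum_triples_two:
  assumes \<Delta>: "kasami_\<Delta> k = (kasami_\<Delta> 2 :: 'a set)" and v: "v1 \<noteq> 0" "v2 \<noteq> 0" "v1 \<noteq> (v2::'a)"
    and n: "n \<ge> 2"
  shows "card (zero_sum_triples k v1 v2) = 2 ^ (2 * n - 3)"
proof -
  define Z where "Z = {w. form v1 v2 6 w + form v1 v2 5 w = 0}"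
  define P where "P = (\<lambda>(x, y, z). (segre x, segre y, segre z))"
  have Z_iff: "(x, y, z) \<in> Z \<longleftrightarrow> v1 * segre x + v2 * segre y + (v1 + v2) * segre z = 0" for x y z
    by (simp add: Z_def form_def segre_def algebra_simps)
  have "card Z = 8 * card (P ` Z)"
  proof (rule card_eq_mult_card_image)
    fix y
    assume "y \<in> P ` Z"
    then obtain a b c where abc: "y = (segre a, segre b, segre c)" "(a, b, c) \<in> Z"
      by (auto simp: P_def)
    then have "{x \<in> Z. P x = y} = {t. segre t = segre a} \<times> {t. segre t = segre b} \<times> {t. segre t = segre c}"
      by (auto simp: P_def Z_iff)
    then show "card {x \<in> Z. P x = y} = 8"
      by (simp add: card_cartesian_product card_segre_fibre)
  qed simp
  moreover have "P ` Z = zero_sum_triples k v1 v2"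
  proof
    show "P ` Z \<subseteq> zero_sum_triples k v1 v2"
      unfolding zero_sum_triples_def \<Delta> kasami_Delta_2 by (auto simp: P_def Z_iff)
    show "zero_sum_triples k v1 v2 \<subseteq> P ` Z"
    proof
      fix w
      assume "w \<in> zero_sum_triples k v1 v2"
      then obtain x y z where "w = P (x, y, z)" "(x, y, z) \<in> Z"
        unfolding zero_sum_triples_def \<Delta> kasami_Delta_2 by (auto simp: P_def Z_iff)
      then show "w \<in> P ` Z"
        by blast
    qed
  qed
  moreover have "card Z = 2 ^ n * 2 ^ n"
    unfolding Z_def by (rule card_forms_sum_zero[OF v])
  moreover have "n + n = (2 * n - 3) + 3"
    using n by simp
  then have "(2::nat) ^ n * 2 ^ n = 2 ^ (2 * n - 3) * 2 ^ 3"
    by (simp only: power_add[symmetric])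
  ultimately show ?thesis
    by simp
qed

end

(* The subtraction in 2 * n - 3 truncates only for n = 1, where the claim is
   vacuous: a field with two elements has no two distinct nonzero elements. *)
theorem corollary11p12:
  fixes k n :: nat
  assumes "k > 0" and "n > 0" and "coprime k n"
    and "CARD('a::{field,finite}) = 2 ^ n"
  shows "([int k = 2] (mod int n) \<or> [int k = - 2] (mod int n) \<longrightarrow>
           (\<forall>v1 v2 :: 'a. v1 \<noteq> 0 \<and> v2 \<noteq> 0 \<and> v1 \<noteq> v2 \<longrightarrow>
              card (zero_sum_triples k v1 v2) = 2 ^ (2 * n - 3))) \<and>
         ((\<exists>r \<in> {1, 2, int n - 2, int n - 1}. [int k = r] (mod int n)) \<longrightarrow>
           (\<forall>v1 v2 :: 'a. v1 \<noteq> 0 \<and> v2 \<noteq> 0 \<and> v1 \<noteq> v2 \<longrightarrow>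
              card (zero_sum_triples k v1 v2) = 2 ^ (2 * n - 3)))"
proof -
  interpret binary_field n "TYPE('a)"
    by standard (fact assms(4))
  have cong_pos: "[k = r] (mod n)" if "[int k = int r] (mod int n)" for r
    using that by (simp add: cong_int_iff)
  have cong_neg: "[k + r = 0] (mod n)" if "[int k = - int r] (mod int n)" for r
    using cong_add[OF that cong_refl[of "int r"]] cong_int_iff[of "k + r" 0 n] by simp
  have n: "n \<ge> 2" if "v1 \<noteq> 0" "v2 \<noteq> 0" "v1 \<noteq> v2" for v1 v2 :: 'a
  proof (rule ccontr)
    assume "\<not> n \<ge> 2"
    then have "n = 1"
      using \<open>n > 0\<close> by simp
    moreover have "card {0, v1, v2} \<le> CARD('a)"
      by (intro card_mono) auto
    ultimately show False
      using that card_field by simp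
  qed
  have one: "card (zero_sum_triples k v1 v2) = 2 ^ (2 * n - 3)"
    if "[int k = 1] (mod int n) \<or> [int k = - 1] (mod int n)"
      "v1 \<noteq> 0" "v2 \<noteq> 0" "v1 \<noteq> v2" for v1 v2 :: 'a
  proof -
    have "kasami_\<Delta> k = (kasami_\<Delta> 1 :: 'a set)"
      using that(1) cong_pos[of 1] cong_neg[of 1] kasami_Delta_cong[of k 1]
        kasami_Delta_cong_uminus[of k 1] by auto
    then show ?thesis
      using card_zero_sum_triples_linear that n kasami_Delta_1 by simp
  qed
  have two: "card (zero_sum_triples k v1 v2) = 2 ^ (2 * n - 3)"
    if k2: "[int k = 2] (mod int n) \<or> [int k = - 2] (mod int n)"
      and v: "v1 \<noteq> 0" "v2 \<noteq> 0" "v1 \<noteq> v2" for v1 v2 :: 'a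
  proof -
    have cases: "[k = 2] (mod n) \<or> [k + 2 = 0] (mod n)"
      using k2 cong_pos[of 2] cong_neg[of 2] by auto
    \<comment> \<open>For even \<open>n\<close>, a residue of 2 or -2 would make \<open>k\<close>
      even, against coprimality.\<close>
    have "odd n"
    proof
      assume "even n"
      then have "[k = 2] (mod 2) \<or> [k + 2 = 0] (mod 2)"
        using cases by (auto intro: cong_dvd_modulus_nat)
      then have "even k"
        by (auto simp: cong_def even_iff_mod_2_eq_zero)
      with \<open>even n\<close> \<open>coprime k n\<close> show False
        by (metis coprime_common_divisor odd_one)
    qed
    then interpret odd_binary_field n "TYPE('a)"
      by unfold_locales
    have "kasami_\<Delta> k = (kasami_\<Delta> 2 :: 'a set)"
      using cases kasami_Delta_cong kasami_Delta_cong_uminus by blast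
    then show ?thesis
      using card_zero_sum_triples_two v n by blast
  qed
  have shift: "[int k = int n - r] (mod int n) \<longleftrightarrow> [int k = - r] (mod int n)" for r
    by (simp add: cong_def mod_diff_left_eq[of "int n" "int n" r, symmetric])
  show ?thesis
    using one two by (auto simp: shift)
qed

end
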